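(* There exists a map $F:\ell^2\to\ell^2$ of class $\mathcal{C}^1$ in the Fréchet sense, with $F(0)=0$, such that the spectrum of the linearized operator $DF(0)\in\mathcal{L}(\ell^2)$ intersects the open half-plane $\{z\in\mathbb{C}:\operatorname{Re}(z)>0\}$, but the equilibrium point $x=0$ of the ordinary differential equation $x'=F(x)$ in $\ell^2$ is asymptotically stable in the sense of Lyapunov; in fact, $x=0$ is globally asymptotically stable.
   Context: Here $\ell^2$ is the infinite-dimensional real Hilbert space of square-summable sequences with its norm $|\cdot|$, and $\mathcal{L}(\ell^2)$ is the space of bounded linear operators on $\ell^2$ with the operator norm. The spectrum of an operator in $\mathcal{L}(\ell^2)$ means the spectrum of its complexification. A map is of class $\mathcal{C}^1$ in the Fréchet sense if it is Fréchet differentiable at every point and $x\mapsto DF(x)\in\mathcal{L}(\ell^2)$ is continuous for the operator norm. The equilibrium $0$ is stable in the sense of Lyapunov if for every $\eta>0$ there is $\delta>0$ such that every solution with $|x(0)|<\delta$ is defined for all $t\ge 0$ and satisfies $|x(t)|<\eta$ for all $t\ge 0$. It is asymptotically stable if it is stable and there is $\delta_0>0$ such that $|x(t)|\to 0$ as $t\to\infty$ for every solution with $|x(0)|<\delta_0$. It is globally asymptotically stable if it is stable and every solution, for any initial condition $x(0)\in\ell^2$, is defined for all $t\ge 0$ and satisfies $|x(t)|\to 0$ as $t\to\infty$. *)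

theory Defs
  imports "HOL-Analysis.Analysis"
begin

section \<open>The real Hilbert space of square-summable sequences\<close>

typedef ell2 = "{x :: nat \<Rightarrow> real. summable (\<lambda>n. (x n)\<^sup>2)}"
  morphisms ell2_nth Abs_ell2
  by (rule exI[of _ "\<lambda>_. 0"]) simp

setup_lifting type_definition_ell2

lemma summable_ell2_power2: "summable (\<lambda>n. (ell2_nth x n)\<^sup>2)"
  using ell2_nth[of x] by simp

lemma ell2_eqI: "(\<And>n. ell2_nth x n = ell2_nth y n) \<Longrightarrow> x = y"
  by (simp add: ell2_nth_inject[symmetric] fun_eq_iff)

lemma summable_mult_of_power2:
  fixes f g :: "nat \<Rightarrow> real"
  assumes "summable (\<lambda>n. (f n)\<^sup>2)" "summable (\<lambda>n. (g n)\<^sup>2)"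
  shows "summable (\<lambda>n. f n * g n)"
proof (rule summable_comparison_test')
  show "summable (\<lambda>n. (f n)\<^sup>2 + (g n)\<^sup>2)"
    using assms by (rule summable_add)
  fix n
  have "2 * (\<bar>f n\<bar> * \<bar>g n\<bar>) \<le> (f n)\<^sup>2 + (g n)\<^sup>2"
    using sum_squares_bound[of "\<bar>f n\<bar>" "\<bar>g n\<bar>"] by simp
  moreover have "0 \<le> \<bar>f n\<bar> * \<bar>g n\<bar>" by simp
  ultimately show "norm (f n * g n) \<le> (f n)\<^sup>2 + (g n)\<^sup>2"
    unfolding real_norm_def abs_mult by linarith
qed

lemma summable_add_power2:
  fixes f g :: "nat \<Rightarrow> real"
  assumes "summable (\<lambda>n. (f n)\<^sup>2)" "summable (\<lambda>n. (g n)\<^sup>2)"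
  shows "summable (\<lambda>n. (f n + g n)\<^sup>2)"
proof -
  have "summable (\<lambda>n. (f n)\<^sup>2 + (g n)\<^sup>2 + 2 * (f n * g n))"
    by (intro summable_add assms summable_mult summable_mult_of_power2)
  then show ?thesis by (simp add: power2_sum mult.assoc)
qed

lemma summable_ell2_mult: "summable (\<lambda>n. ell2_nth x n * ell2_nth y n)"
  by (intro summable_mult_of_power2 summable_ell2_power2)

instantiation ell2 :: real_vector
begin

lift_definition zero_ell2 :: ell2 is "\<lambda>_. 0" by simp

lift_definition plus_ell2 :: "ell2 \<Rightarrow> ell2 \<Rightarrow> ell2" is "\<lambda>x y n. x n + y n"
  by (rule summable_add_power2)

lift_definition uminus_ell2 :: "ell2 \<Rightarrow> ell2" is "\<lambda>x n. - x n" by simp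

lift_definition minus_ell2 :: "ell2 \<Rightarrow> ell2 \<Rightarrow> ell2" is "\<lambda>x y n. x n - y n"
  using summable_add_power2[where g = "\<lambda>n. - g n" for g] by fastforce

lift_definition scaleR_ell2 :: "real \<Rightarrow> ell2 \<Rightarrow> ell2" is "\<lambda>c x n. c * x n"
  by (simp add: power_mult_distrib summable_mult)

instance
  by (standard; transfer; simp add: fun_eq_iff algebra_simps)

end

lemma ell2_nth_simps [simp]:
  "ell2_nth 0 n = 0"
  "ell2_nth (x + y) n = ell2_nth x n + ell2_nth y n"
  "ell2_nth (- x) n = - ell2_nth x n"
  "ell2_nth (x - y) n = ell2_nth x n - ell2_nth y n"
  "ell2_nth (c *\<^sub>R x) n = c * ell2_nth x n"
  by (transfer; simp)+

instantiation ell2 :: real_inner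
begin

definition inner_ell2 :: "ell2 \<Rightarrow> ell2 \<Rightarrow> real" where
  "inner_ell2 x y = (\<Sum>n. ell2_nth x n * ell2_nth y n)"

definition norm_ell2 :: "ell2 \<Rightarrow> real" where
  "norm_ell2 x = sqrt (inner x x)"

definition sgn_ell2 :: "ell2 \<Rightarrow> ell2" where
  "sgn_ell2 x = x /\<^sub>R norm x"

definition dist_ell2 :: "ell2 \<Rightarrow> ell2 \<Rightarrow> real" where
  "dist_ell2 x y = norm (x - y)"

definition uniformity_ell2 :: "(ell2 \<times> ell2) filter" where
  "uniformity_ell2 = (INF e\<in>{0 <..}. principal {(x, y). dist x y < e})"

definition open_ell2 :: "ell2 set \<Rightarrow> bool" where
  "open_ell2 U = (\<forall>x\<in>U. eventually (\<lambda>(x', y). x' = x \<longrightarrow> y \<in> U) uniformity)"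

instance
proof
  fix x y z :: ell2 and r :: real
  show "inner x y = inner y x"
    by (simp add: inner_ell2_def mult.commute)
  show "inner (x + y) z = inner x z + inner y z"
    by (simp add: inner_ell2_def distrib_right suminf_add summable_ell2_mult)
  show "inner (r *\<^sub>R x) y = r * inner x y"
    by (simp add: inner_ell2_def mult.assoc suminf_mult summable_ell2_mult)
  show "0 \<le> inner x x"
    unfolding inner_ell2_def by (intro suminf_nonneg summable_ell2_mult) simp
  show "inner x x = 0 \<longleftrightarrow> x = 0"
  proof
    assume "inner x x = 0"
    then have "\<forall>n. ell2_nth x n * ell2_nth x n = 0"
      unfolding inner_ell2_def
      using suminf_eq_zero_iff[OF summable_ell2_mult[of x x]] by simp
    then show "x = 0" by (auto intro: ell2_eqI)
  qed (simp add: inner_ell2_def)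
qed (simp_all add: norm_ell2_def sgn_ell2_def dist_ell2_def uniformity_ell2_def open_ell2_def)

end

lemma norm_ell2_power2: "(norm (x :: ell2))\<^sup>2 = (\<Sum>n. (ell2_nth x n)\<^sup>2)"
  unfolding power2_norm_eq_inner inner_ell2_def by (simp add: power2_eq_square)

lemma sum_ell2_le_norm: "finite A \<Longrightarrow> (\<Sum>n\<in>A. (ell2_nth x n)\<^sup>2) \<le> (norm x)\<^sup>2"
  unfolding norm_ell2_power2 by (intro sum_le_suminf summable_ell2_power2) auto

lemma abs_ell2_nth_le_norm: "\<bar>ell2_nth x n\<bar> \<le> norm x"
  using sum_ell2_le_norm[of "{n}" x] by (simp add: power2_le_iff_abs_le)

instance ell2 :: complete_space
proof
  fix X :: "nat \<Rightarrow> ell2"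
  assume X: "Cauchy X"
  have "Cauchy (\<lambda>i. ell2_nth (X i) n)" for n
  proof (rule metric_CauchyI)
    fix e :: real assume "0 < e"
    then obtain M where M: "\<forall>i\<ge>M. \<forall>j\<ge>M. dist (X i) (X j) < e"
      using metric_CauchyD[OF X] by blast
    have "dist (ell2_nth (X i) n) (ell2_nth (X j) n) \<le> dist (X i) (X j)" for i j
      using abs_ell2_nth_le_norm[of "X i - X j" n] by (simp add: dist_norm)
    with M show "\<exists>M. \<forall>i\<ge>M. \<forall>j\<ge>M. dist (ell2_nth (X i) n) (ell2_nth (X j) n) < e"
      by (meson le_less_trans)
  qed
  then have "\<forall>n. \<exists>l. (\<lambda>i. ell2_nth (X i) n) \<longlonglongrightarrow> l"
    by (simp add: Cauchy_convergent_iff convergent_def)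
  then obtain a where a: "\<And>n. (\<lambda>i. ell2_nth (X i) n) \<longlonglongrightarrow> a n" by metis
  have bnd: "\<exists>M. \<forall>i\<ge>M. \<forall>K. (\<Sum>n<K. (ell2_nth (X i) n - a n)\<^sup>2) \<le> e\<^sup>2" if "0 < e" for e
  proof -
    obtain M where M: "\<forall>i\<ge>M. \<forall>j\<ge>M. dist (X i) (X j) < e"
      using metric_CauchyD[OF X \<open>0 < e\<close>] by blast
    have "(\<Sum>n<K. (ell2_nth (X i) n - a n)\<^sup>2) \<le> e\<^sup>2" if "i \<ge> M" for i K
    proof (rule LIMSEQ_le_const2)
      show "(\<lambda>j. \<Sum>n<K. (ell2_nth (X i) n - ell2_nth (X j) n)\<^sup>2)
          \<longlonglongrightarrow> (\<Sum>n<K. (ell2_nth (X i) n - a n)\<^sup>2)"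
        by (intro tendsto_intros a)
      have "(\<Sum>n<K. (ell2_nth (X i) n - ell2_nth (X j) n)\<^sup>2) \<le> e\<^sup>2" if "j \<ge> M" for j
      proof -
        have "(\<Sum>n<K. (ell2_nth (X i) n - ell2_nth (X j) n)\<^sup>2) \<le> (norm (X i - X j))\<^sup>2"
          using sum_ell2_le_norm[of "{..<K}" "X i - X j"] by simp
        also have "\<dots> \<le> e\<^sup>2"
          using M \<open>i \<ge> M\<close> \<open>j \<ge> M\<close> by (intro power_mono) (auto simp: dist_norm less_imp_le)
        finally show ?thesis .
      qed
      then show "\<exists>N. \<forall>j\<ge>N. (\<Sum>n<K. (ell2_nth (X i) n - ell2_nth (X j) n)\<^sup>2) \<le> e\<^sup>2" by blast
    qed
    then show ?thesis by blast
  qed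
  have summ: "summable (\<lambda>n. (ell2_nth (X i) n - a n)\<^sup>2)"
    if "\<forall>K. (\<Sum>n<K. (ell2_nth (X i) n - a n)\<^sup>2) \<le> e\<^sup>2" for i e
    using that by (intro summableI_nonneg_bounded[where x = "e\<^sup>2"]) auto
  obtain M1 where "\<forall>K. (\<Sum>n<K. (ell2_nth (X M1) n - a n)\<^sup>2) \<le> 1\<^sup>2"
    using bnd[of 1] by auto
  then have "summable (\<lambda>n. (ell2_nth (X M1) n - a n)\<^sup>2)" by (rule summ)
  then have "summable (\<lambda>n. (a n - ell2_nth (X M1) n)\<^sup>2)"
    by (simp add: power2_commute)
  from summable_add_power2[OF this summable_ell2_power2[of "X M1"]]
  have "summable (\<lambda>n. (a n)\<^sup>2)" by simp
  then have A: "ell2_nth (Abs_ell2 a) = a" by (simp add: Abs_ell2_inverse)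
  have "X \<longlonglongrightarrow> Abs_ell2 a"
  proof (rule metric_LIMSEQ_I)
    fix r :: real assume "0 < r"
    then obtain M where M: "\<forall>i\<ge>M. \<forall>K. (\<Sum>n<K. (ell2_nth (X i) n - a n)\<^sup>2) \<le> (r/2)\<^sup>2"
      using bnd[of "r/2"] by auto
    have "dist (X i) (Abs_ell2 a) < r" if "i \<ge> M" for i
    proof -
      have "(norm (X i - Abs_ell2 a))\<^sup>2 \<le> (r/2)\<^sup>2"
        unfolding norm_ell2_power2 ell2_nth_simps A
        using M that summ by (intro suminf_le_const) auto
      then have "norm (X i - Abs_ell2 a) \<le> r/2"
        by (rule power2_le_imp_le) (use \<open>0 < r\<close> in simp)
      then show ?thesis using \<open>0 < r\<close> by (simp add: dist_norm)
    qed
    then show "\<exists>M. \<forall>i\<ge>M. dist (X i) (Abs_ell2 a) < r" by blast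
  qed
  then show "convergent X" by (auto simp: convergent_def)
qed

instance ell2 :: banach ..


section \<open>Spectrum of the complexification of a real operator\<close>

text \<open>
  The complexification of a real normed space is modelled on pairs, where (x, y) stands for
  x + iy; the product norm of the library, sqrt (|x|^2 + |y|^2), is the Hilbert norm of the
  complexification if the space is a Hilbert space.
\<close>

definition cplx_scale :: "complex \<Rightarrow> 'a \<times> 'a \<Rightarrow> 'a \<times> 'a :: real_vector" where
  "cplx_scale z v =
    (Re z *\<^sub>R fst v - Im z *\<^sub>R snd v, Im z *\<^sub>R fst v + Re z *\<^sub>R snd v)"

definition complexification ::
    "('a::real_normed_vector \<Rightarrow>\<^sub>L 'a) \<Rightarrow> (('a \<times> 'a) \<Rightarrow>\<^sub>L ('a \<times> 'a))" where
  "complexification A = Blinfun (\<lambda>v. (A (fst v), A (snd v)))"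

lemma complexification_apply [simp]: "complexification A v = (A (fst v), A (snd v))"
proof -
  have "bounded_linear (\<lambda>v. (A (fst v), A (snd v)))"
    by (intro bounded_linear_Pair bounded_linear_compose[OF blinfun.bounded_linear_right]
        bounded_linear_fst bounded_linear_snd)
  then show ?thesis
    by (simp add: complexification_def bounded_linear_Blinfun_apply)
qed

definition operator_spectrum :: "('a::real_normed_vector \<Rightarrow>\<^sub>L 'a) \<Rightarrow> complex set" where
  "operator_spectrum A =
    {z. \<not> (\<exists>B :: ('a \<times> 'a) \<Rightarrow>\<^sub>L ('a \<times> 'a).
          (\<forall>c v. B (cplx_scale c v) = cplx_scale c (B v)) \<and>
          (\<forall>v. B (cplx_scale z v - complexification A v) = v) \<and>
          (\<forall>v. cplx_scale z (B v) - complexification A (B v) = v))}"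


section \<open>Solutions and stability\<close>

text \<open>
  Solutions are considered forward in time, on intervals that start at 0 and may be closed,
  half-open or unbounded on the right.  The degenerate interval {0} is admitted; this can only
  strengthen statements about all maximal solutions, because then every initial value has a
  maximal solution, even without a local existence theorem.
\<close>

definition ode_solution :: "('a \<Rightarrow> 'a) \<Rightarrow> (real \<Rightarrow> 'a::real_normed_vector) \<Rightarrow> real set \<Rightarrow> bool" where
  "ode_solution F x J \<longleftrightarrow> is_interval J \<and> 0 \<in> J \<and> J \<subseteq> {0..} \<and>
    (\<forall>t\<in>J. (x has_vector_derivative F (x t)) (at t within J))"

definition maximal_ode_solution ::
    "('a \<Rightarrow> 'a) \<Rightarrow> (real \<Rightarrow> 'a::real_normed_vector) \<Rightarrow> real set \<Rightarrow> bool" where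
  "maximal_ode_solution F x J \<longleftrightarrow> ode_solution F x J \<and>
    \<not> (\<exists>y K. ode_solution F y K \<and> J \<subset> K \<and> (\<forall>t\<in>J. y t = x t))"

text \<open>The following notions refer to the equilibrium 0 of the equation x' = F(x).\<close>

definition lyapunov_stable :: "('a \<Rightarrow> 'a::real_normed_vector) \<Rightarrow> bool" where
  "lyapunov_stable F \<longleftrightarrow> (\<forall>\<eta>>0. \<exists>\<delta>>0. \<forall>x J.
    maximal_ode_solution F x J \<longrightarrow> norm (x 0) < \<delta> \<longrightarrow>
      J = {0..} \<and> (\<forall>t\<ge>0. norm (x t) < \<eta>))"

definition asymptotically_stable :: "('a \<Rightarrow> 'a::real_normed_vector) \<Rightarrow> bool" where
  "asymptotically_stable F \<longleftrightarrow> lyapunov_stable F \<and> (\<exists>\<delta>>0. \<forall>x J.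
    maximal_ode_solution F x J \<longrightarrow> norm (x 0) < \<delta> \<longrightarrow>
      J = {0..} \<and> ((\<lambda>t. norm (x t)) \<longlongrightarrow> 0) at_top)"

definition globally_asymptotically_stable :: "('a \<Rightarrow> 'a::real_normed_vector) \<Rightarrow> bool" where
  "globally_asymptotically_stable F \<longleftrightarrow> lyapunov_stable F \<and> (\<forall>x J.
    maximal_ode_solution F x J \<longrightarrow>
      J = {0..} \<and> ((\<lambda>t. norm (x t)) \<longlongrightarrow> 0) at_top)"

end

(*
Kakutani's weighted backward shift A has the entry 8 / 2^k in row n, where 2^k is the exact power
of 2 dividing n + 1, and 2 is one of its eigenvalues; hence 1 is an eigenvalue of A - id.  Deleting
all entries with k \<ge> K changes the norm by O(2^-K) and leaves a direct sum of nilpotent blocks of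
size 2^K.  The field F(x) = A(|x|) x - x, in which the entries of level k are switched off as |x|
grows to r_k, is therefore C^1 with DF(0) = A - id.  As long as |x| \<ge> r_K only the levels k < K
are active, and the norm with weights 32^(n mod 2^K) decays exponentially along solutions; it is
equivalent to |x| up to the factor 32^(2^K).  Since r_K is much smaller than 32^-(2^K), a solution
that enters the ball of radius r_K stays in a ball whose radius tends to 0 with K.
*)
theory Submission
  imports Defs "HOL-Computational_Algebra.Primes"
begin

section \<open>Equations with a Lipschitz right-hand side\<close>

lemma integral_has_vector_derivative_atLeast:
  fixes f :: "real \<Rightarrow> 'a::banach"
  assumes "continuous_on {a..} f" and "a \<le> t"
  shows "((\<lambda>u. integral {a..u} f) has_vector_derivative f t) (at t within {a..})"
proof -
  have "((\<lambda>u. integral {a..u} f) has_vector_derivative f t) (at t within {a..t+1})"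
    using assms by (intro integral_has_vector_derivative continuous_on_subset[OF assms(1)]) auto
  \<comment> \<open>The filter only sees points near \<open>t\<close>, so a compact interval
    reaching beyond \<open>t\<close> replaces the half-line.\<close>
  moreover have "at t within {a..t+1} = at t within {a..}"
    using \<open>a \<le> t\<close> by (intro at_within_nhd[of t "{..<t+1}"]) auto
  ultimately show ?thesis by simp
qed

text \<open>Integrating the exponential gains the factor \<open>1 / b\<close>; with
  \<open>b = 2 * L\<close> it makes the Picard operator below halve distances.\<close>

lemma norm_integral_exp_bound:
  fixes f :: "real \<Rightarrow> 'a::banach"
  assumes cont: "continuous_on {0..t} f" and "0 \<le> t" and "0 < b" and "0 \<le> C"
    and le: "\<And>s. s \<in> {0..t} \<Longrightarrow> norm (f s) \<le> C * exp (b * s)"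
  shows "norm (integral {0..t} f) \<le> C / b * exp (b * t)"
proof -
  have "((\<lambda>s. C * exp (b * s)) has_integral (C / b * exp (b * t) - C / b * exp (b * 0))) {0..t}"
    using \<open>0 \<le> t\<close> \<open>0 < b\<close>
    by (intro fundamental_theorem_of_calculus)
      (auto intro!: derivative_eq_intros simp: has_real_derivative_iff_has_vector_derivative[symmetric])
  then have I: "(\<lambda>s. C * exp (b * s)) integrable_on {0..t}"
      "integral {0..t} (\<lambda>s. C * exp (b * s)) = C / b * exp (b * t) - C / b"
    by (auto simp: has_integral_iff)
  have "norm (integral {0..t} f) \<le> integral {0..t} (\<lambda>s. C * exp (b * s))"
    using le by (intro integral_norm_bound_integral integrable_continuous_real cont I)
  also have "\<dots> \<le> C / b * exp (b * t)"
    using I \<open>0 < b\<close> \<open>0 \<le> C\<close> by simp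
  finally show ?thesis .
qed

lemma lipschitz_imp_ode_solution:
  fixes F :: "'a::banach \<Rightarrow> 'a"
  assumes L: "0 < L" and lip: "\<And>x y. norm (F x - F y) \<le> L * norm (x - y)"
  shows "\<exists>x. x 0 = x0 \<and> ode_solution F x {0..}"
proof -
  have contF: "continuous_on UNIV F"
    by (rule lipschitz_on_continuous_on[of L]) (use L lip in \<open>auto simp: lipschitz_on_def dist_norm\<close>)
  \<comment> \<open>The weight exp (2 L t) makes the Picard operator a contraction on the whole half-line.\<close>
  define f where "f u s = F (exp (2 * L * s) *\<^sub>R apply_bcontfun u s)" for u s
  define g where "g u t = exp (- 2 * L * t) *\<^sub>R (x0 + integral {0..t} (f u))" for u t
  \<comment> \<open>Bounded continuous functions live on the whole real line, so \<open>g u\<close>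
    is continued to negative times by its value at 0.\<close>
  define \<Phi> where "\<Phi> u t = g u (max t 0)" for u t
  have contf: "continuous_on S (f u)" for u S
    unfolding f_def
    by (rule continuous_on_compose2[OF contF]) (auto intro!: continuous_intros)
  have contI: "continuous_on {0..} (\<lambda>t. integral {0..t} (f u))" for u
    unfolding continuous_on_eq_continuous_within
    using integral_has_vector_derivative_atLeast[OF contf, of 0 _ u]
    by (auto intro: has_vector_derivative_continuous)
  have "continuous_on UNIV (\<Phi> u)" for u
  proof -
    have "continuous_on {0..} (g u)"
      unfolding g_def by (intro continuous_intros contI)
    then show ?thesis
      unfolding \<Phi>_def by (rule continuous_on_compose2) (auto intro!: continuous_intros)
  qed
  \<comment> \<open>The weight cancels the exponential growth of the integral, so the bound is
    uniform in \<open>t\<close>.\<close>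
  moreover have "norm (\<Phi> u t) \<le> norm x0 + (norm (F 0) + L * norm u) / (2 * L)" for u t
  proof -
    define T where "T = max t 0"
    define C where "C = norm (F 0) + L * norm u"
    have "0 \<le> C" using L by (simp add: C_def)
    have "norm (f u s) \<le> C * exp (2 * L * s)" if "s \<in> {0..T}" for s
    proof -
      have "norm (f u s) \<le> norm (F 0) + norm (f u s - F 0)" by norm
      also have "norm (f u s - F 0) \<le> L * (exp (2 * L * s) * norm (apply_bcontfun u s))"
        using lip[of "exp (2 * L * s) *\<^sub>R apply_bcontfun u s" 0] by (simp add: f_def)
      also have "\<dots> \<le> L * (exp (2 * L * s) * norm u)"
        using L norm_bounded[of u s] by (intro mult_left_mono) auto
      also have "norm (F 0) \<le> norm (F 0) * exp (2 * L * s)"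
        using that L mult_left_mono[of 1 "exp (2 * L * s)" "norm (F 0)"] by simp
      finally show ?thesis by (simp add: C_def algebra_simps)
    qed
    then have "norm (integral {0..T} (f u)) \<le> C / (2 * L) * exp (2 * L * T)"
      using L \<open>0 \<le> C\<close> by (intro norm_integral_exp_bound contf) (auto simp: T_def)
    then have "norm (\<Phi> u t) \<le> exp (- 2 * L * T) * (norm x0 + C / (2 * L) * exp (2 * L * T))"
      unfolding \<Phi>_def g_def T_def[symmetric]
      using norm_triangle_ineq[of x0 "integral {0..T} (f u)"] by simp
    also have "\<dots> = exp (- 2 * L * T) * norm x0 + C / (2 * L)"
      by (simp add: algebra_simps exp_minus)
    also have "exp (- 2 * L * T) * norm x0 \<le> 1 * norm x0"
      using L by (intro mult_right_mono) (auto simp: T_def)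
    finally show ?thesis by (simp add: C_def)
  qed
  ultimately have "\<Phi> u \<in> bcontfun" for u by (intro bcontfun_normI) auto
  then have app: "apply_bcontfun (Bcontfun (\<Phi> u)) = \<Phi> u" for u by (simp add: Bcontfun_inverse)
  have "dist (Bcontfun (\<Phi> u)) (Bcontfun (\<Phi> v)) \<le> 1 / 2 * dist u v" for u v
  proof (rule dist_bound)
    fix t :: real
    define T where "T = max t 0"
    have fd: "norm (f u s - f v s) \<le> (L * dist u v) * exp (2 * L * s)" for s
    proof -
      have "norm (f u s - f v s) \<le> L * norm (exp (2 * L * s) *\<^sub>R (apply_bcontfun u s - apply_bcontfun v s))"
        using lip by (simp add: f_def scaleR_diff_right)
      also have "\<dots> \<le> L * (exp (2 * L * s) * dist u v)"
        using L dist_bounded[of u s v] by (auto simp: dist_norm intro!: mult_left_mono)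
      finally show ?thesis by (simp add: algebra_simps)
    qed
    have "norm (integral {0..T} (\<lambda>s. f u s - f v s)) \<le> L * dist u v / (2 * L) * exp (2 * L * T)"
      using L fd by (intro norm_integral_exp_bound continuous_on_diff contf) (auto simp: T_def)
    moreover have "integral {0..T} (\<lambda>s. f u s - f v s) = integral {0..T} (f u) - integral {0..T} (f v)"
      by (intro integral_diff integrable_continuous_real contf)
    moreover have "\<Phi> u t - \<Phi> v t = exp (- 2 * L * T) *\<^sub>R (integral {0..T} (f u) - integral {0..T} (f v))"
      by (simp add: \<Phi>_def g_def T_def algebra_simps)
    ultimately have "norm (\<Phi> u t - \<Phi> v t) \<le> exp (- 2 * L * T) * (dist u v / 2 * exp (2 * L * T))"
      using L by simp
    then show "dist (apply_bcontfun (Bcontfun (\<Phi> u)) t) (apply_bcontfun (Bcontfun (\<Phi> v)) t)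
        \<le> 1 / 2 * dist u v"
      by (simp add: app dist_norm exp_minus field_simps)
  qed
  then obtain u where u: "Bcontfun (\<Phi> u) = u"
    using banach_fix_type[of "1/2" "\<lambda>u. Bcontfun (\<Phi> u)"] by auto
  \<comment> \<open>Undoing the weight turns the fixed point \<open>u\<close> into a solution of the
    integral equation.\<close>
  define x where "x t = x0 + integral {0..t} (f u)" for t
  have ux: "apply_bcontfun u t = exp (- 2 * L * t) *\<^sub>R x t" if "0 \<le> t" for t
    using that app[of u] u by (simp add: \<Phi>_def g_def x_def)
  have "(x has_vector_derivative F (x t)) (at t within {0..})" if "0 \<le> t" for t
  proof -
    have "(x has_vector_derivative 0 + f u t) (at t within {0..})"
      unfolding x_def
      by (intro derivative_intros integral_has_vector_derivative_atLeast contf that)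
    moreover have "f u t = F (x t)"
      using ux[OF that] by (simp add: f_def exp_minus)
    ultimately show ?thesis by simp
  qed
  moreover have "x 0 = x0" by (simp add: x_def)
  ultimately show ?thesis
    by (auto simp: ode_solution_def is_interval_ci)
qed

section \<open>Restriction, energy estimate and uniqueness of solutions\<close>

lemma ode_solution_subset:
  assumes "ode_solution F x J" "is_interval I" "0 \<in> I" "I \<subseteq> J"
  shows "ode_solution F x I"
proof -
  have "(x has_vector_derivative F (x t)) (at t within I)" if "t \<in> I" for t
  proof (rule has_vector_derivative_within_subset)
    show "(x has_vector_derivative F (x t)) (at t within J)"
      using assms that unfolding ode_solution_def by blast
  qed fact
  moreover have "I \<subseteq> {0..}"
    using assms unfolding ode_solution_def by blast
  ultimately show ?thesis
    using assms by (simp add: ode_solution_def)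
qed

lemma ode_solution_continuous_on:
  assumes "ode_solution F x J"
  shows "continuous_on J x"
  unfolding continuous_on_eq_continuous_within
proof
  fix t assume "t \<in> J"
  with assms show "continuous (at t within J) x"
    unfolding ode_solution_def by (intro has_vector_derivative_continuous[of x "F (x t)"]) simp
qed

lemma ode_solution_interior:
  assumes sol: "ode_solution F x J" and ab: "{a..b} \<subseteq> J" and t: "a < t" "t < b"
  shows "(x has_vector_derivative F (x t)) (at t)"
proof -
  have "t \<in> J" and sub: "{a<..<b} \<subseteq> J"
    using ab t by auto
  then have "(x has_vector_derivative F (x t)) (at t within J)"
    using sol unfolding ode_solution_def by blast
  then have "(x has_vector_derivative F (x t)) (at t within {a<..<b})"
    using sub by (rule has_vector_derivative_within_subset)
  then show ?thesis
    using at_within_open[of t "{a<..<b}"] t by simp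
qed

text \<open>Serves both energy estimates: \<open>c = - 2 * L\<close> for uniqueness and
  \<open>c = 1\<close> for decay in a scaled norm.\<close>

lemma has_real_derivative_exp_norm_square:
  fixes z :: "real \<Rightarrow> 'a::real_inner"
  assumes "(z has_vector_derivative w) (at t)"
  shows "((\<lambda>s. exp (c * s) * (norm (z s))\<^sup>2) has_real_derivative
    exp (c * t) * (c * (norm (z t))\<^sup>2 + 2 * (z t \<bullet> w))) (at t)"
proof -
  have "((\<lambda>s. z s \<bullet> z s) has_derivative (\<lambda>h. z t \<bullet> (h *\<^sub>R w) + (h *\<^sub>R w) \<bullet> z t)) (at t)"
    using assms unfolding has_vector_derivative_def by (intro has_derivative_inner)
  then have "((\<lambda>s. z s \<bullet> z s) has_real_derivative 2 * (z t \<bullet> w)) (at t)"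
    by (rule has_derivative_imp_has_field_derivative) (simp add: inner_commute)
  then have "((\<lambda>s. (norm (z s))\<^sup>2) has_real_derivative 2 * (z t \<bullet> w)) (at t)"
    by (simp add: power2_norm_eq_inner)
  moreover have "((\<lambda>s. exp (c * s)) has_real_derivative c * exp (c * t)) (at t)"
    by (auto intro!: derivative_eq_intros)
  ultimately show ?thesis
    by (auto dest: DERIV_mult simp: algebra_simps)
qed

text \<open>Gronwall argument: the squared distance grows at rate at most \<open>2 * L\<close>, so
  its product with \<open>exp (- 2 * L * s)\<close> is nonincreasing, and it starts at 0.\<close>

lemma lipschitz_ode_solution_unique:
  fixes F :: "'a::real_inner \<Rightarrow> 'a"
  assumes lip: "\<And>x y. norm (F x - F y) \<le> L * norm (x - y)"
    and x: "ode_solution F x J" and y: "ode_solution F y J" and eq: "x 0 = y 0" and t: "t \<in> J"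
  shows "x t = y t"
proof -
  define d where "d s = exp (- 2 * L * s) * (norm (x s - y s))\<^sup>2" for s
  have t0: "0 \<le> t"
    using x t by (auto simp: ode_solution_def)
  have sub: "{0..t} \<subseteq> J"
    using x t mem_is_interval_1_I[of J 0 t] by (auto simp: ode_solution_def)
  have "d 0 \<ge> d t"
  proof (rule DERIV_nonpos_imp_decreasing_open[OF t0])
    fix s assume s: "0 < s" "s < t"
    let ?z = "x s - y s" and ?w = "F (x s) - F (y s)"
    have "((\<lambda>s. x s - y s) has_vector_derivative ?w) (at s)"
      by (intro derivative_intros ode_solution_interior[OF x sub s] ode_solution_interior[OF y sub s])
    then have "(d has_real_derivative
        exp (- 2 * L * s) * (- 2 * L * (norm ?z)\<^sup>2 + 2 * (?z \<bullet> ?w))) (at s)"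
      unfolding d_def by (rule has_real_derivative_exp_norm_square)
    moreover have "?z \<bullet> ?w \<le> L * (norm ?z)\<^sup>2"
    proof -
      have "?z \<bullet> ?w \<le> norm ?z * norm ?w" by (rule norm_cauchy_schwarz)
      also have "\<dots> \<le> norm ?z * (L * norm ?z)" by (intro mult_left_mono lip) auto
      finally show ?thesis by (simp add: power2_eq_square algebra_simps)
    qed
    ultimately show "\<exists>y. DERIV d s :> y \<and> y \<le> 0"
      by (intro exI conjI) (auto simp: mult_le_0_iff)
  next
    show "continuous_on {0..t} d"
      unfolding d_def
      by (intro continuous_intros continuous_on_subset[OF ode_solution_continuous_on[OF x] sub]
          continuous_on_subset[OF ode_solution_continuous_on[OF y] sub])
  qed
  then have "d t \<le> 0" using eq by (simp add: d_def)
  then show ?thesis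
    by (simp add: d_def mult_le_0_iff)
qed

text \<open>By uniqueness the global solution with the same initial value extends \<open>x\<close>,
  which contradicts maximality if \<open>J\<close> is smaller than the half-line.\<close>

lemma lipschitz_maximal_ode_solution:
  fixes F :: "'a::{real_inner, banach} \<Rightarrow> 'a"
  assumes L: "0 < L" and lip: "\<And>x y. norm (F x - F y) \<le> L * norm (x - y)"
    and max: "maximal_ode_solution F x J"
  shows "J = {0..}"
proof (rule ccontr)
  have x: "ode_solution F x J" using max by (simp add: maximal_ode_solution_def)
  then have J: "is_interval J" "0 \<in> J" "J \<subseteq> {0..}" by (auto simp: ode_solution_def)
  obtain y where y: "y 0 = x 0" "ode_solution F y {0..}"
    using lipschitz_imp_ode_solution[OF L lip] by blast
  have "ode_solution F y J"
    by (rule ode_solution_subset[OF y(2) J])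
  then have "\<forall>t\<in>J. y t = x t"
    using lipschitz_ode_solution_unique[of F L y J x] lip x y(1) by simp
  moreover assume "J \<noteq> {0..}"
  then have "J \<subset> {0..}" using J by blast
  ultimately have "\<exists>y K. ode_solution F y K \<and> J \<subset> K \<and> (\<forall>t\<in>J. y t = x t)"
    using y(2) by (intro exI[of _ y] exI[of _ "{0..}"]) simp
  then show False using max by (simp add: maximal_ode_solution_def)
qed

section \<open>Weighted shifts\<close>

lemma summable_ell2_shift: "summable (\<lambda>n. (ell2_nth x (n + j))\<^sup>2)"
  using summable_iff_shift[of "\<lambda>n. (ell2_nth x n)\<^sup>2" j] summable_ell2_power2 by simp

text \<open>Dropping the first \<open>j\<close> coordinates can only decrease the norm, so a
  coordinatewise comparison suffices.\<close>

lemma norm_ell2_le_shift: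
  assumes "\<And>n. \<bar>ell2_nth y n\<bar> \<le> C * \<bar>ell2_nth x (n + j)\<bar>" and "0 \<le> C"
  shows "norm y \<le> C * norm x"
proof (rule power2_le_imp_le)
  have "(norm y)\<^sup>2 = (\<Sum>n. (ell2_nth y n)\<^sup>2)" by (rule norm_ell2_power2)
  also have "\<dots> \<le> (\<Sum>n. C\<^sup>2 * (ell2_nth x (n + j))\<^sup>2)"
  proof (intro suminf_le summable_ell2_power2 summable_mult summable_ell2_shift)
    show "(ell2_nth y n)\<^sup>2 \<le> C\<^sup>2 * (ell2_nth x (n + j))\<^sup>2" for n
      using power_mono[OF assms(1)[of n], of 2] by (simp add: power_mult_distrib)
  qed
  also have "\<dots> = C\<^sup>2 * (\<Sum>n. (ell2_nth x (n + j))\<^sup>2)"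
    by (intro suminf_mult summable_ell2_shift)
  also have "(\<Sum>n. (ell2_nth x (n + j))\<^sup>2) \<le> (norm x)\<^sup>2"
    using suminf_split_initial_segment[OF summable_ell2_power2[of x], of j]
    by (simp add: norm_ell2_power2 sum_nonneg)
  finally show "(norm y)\<^sup>2 \<le> (C * norm x)\<^sup>2"
    by (simp add: power_mult_distrib mult_left_mono)
qed (use assms in simp)

text \<open>One form for two uses: \<open>j = 1\<close> gives the shifts in the vector field,
  \<open>j = 0\<close> a diagonal rescaling. For bounded \<open>d\<close> both abstraction functions
  receive admissible arguments.\<close>

definition weighted_shift :: "(nat \<Rightarrow> real) \<Rightarrow> nat \<Rightarrow> ell2 \<Rightarrow>\<^sub>L ell2" where
  "weighted_shift d j = Blinfun (\<lambda>x. Abs_ell2 (\<lambda>n. d n * ell2_nth x (n + j)))"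

lemma
  assumes d: "\<And>n. \<bar>d n\<bar> \<le> C"
  shows weighted_shift_nth: "ell2_nth (weighted_shift d j x) n = d n * ell2_nth x (n + j)"
    and norm_weighted_shift_le: "norm (weighted_shift d j) \<le> C"
proof -
  have "0 \<le> C" using d[of 0] by linarith
  define f where "f x = Abs_ell2 (\<lambda>n. d n * ell2_nth x (n + j))" for x
  have nth: "ell2_nth (f x) n = d n * ell2_nth x (n + j)" for x n
  proof -
    have "summable (\<lambda>n. (d n * ell2_nth x (n + j))\<^sup>2)"
    proof (rule summable_comparison_test')
      show "summable (\<lambda>n. C\<^sup>2 * (ell2_nth x (n + j))\<^sup>2)"
        by (intro summable_mult summable_ell2_shift)
      show "norm ((d n * ell2_nth x (n + j))\<^sup>2) \<le> C\<^sup>2 * (ell2_nth x (n + j))\<^sup>2" for n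
        using power_mono[OF d[of n], of 2] by (simp add: power_mult_distrib mult_right_mono)
    qed
    then show ?thesis by (simp add: f_def Abs_ell2_inverse)
  qed
  have bound: "norm (f x) \<le> C * norm x" for x
    using d \<open>0 \<le> C\<close>
    by (intro norm_ell2_le_shift[of _ _ _ j]) (auto simp: nth abs_mult intro!: mult_right_mono)
  have "bounded_linear f"
  proof (rule bounded_linear_intro[where K = C])
    show "norm (f x) \<le> norm x * C" for x
      using bound[of x] by (simp add: mult.commute)
  qed (auto intro!: ell2_eqI simp: nth distrib_left mult.left_commute)
  then have app: "blinfun_apply (weighted_shift d j) = f"
    by (simp add: weighted_shift_def f_def[abs_def] bounded_linear_Blinfun_apply)
  show "ell2_nth (weighted_shift d j x) n = d n * ell2_nth x (n + j)"
    by (simp add: app nth)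
  show "norm (weighted_shift d j) \<le> C"
    using \<open>0 \<le> C\<close> bound by (intro norm_blinfun_bound) (auto simp: app)
qed

section \<open>Radial cutoffs\<close>

text \<open>The square makes the function continuously differentiable: both one-sided derivatives
  vanish at 1.\<close>

definition cutoff :: "real \<Rightarrow> real" where
  "cutoff s = (max 0 (1 - s))\<^sup>2"

lemma cutoff_nonneg: "0 \<le> cutoff s"
  by (simp add: cutoff_def)

lemma cutoff_0 [simp]: "cutoff 0 = 1"
  by (simp add: cutoff_def)

lemma cutoff_le_1: "0 \<le> s \<Longrightarrow> cutoff s \<le> 1"
  unfolding cutoff_def by (rule power_le_one) auto

lemma cutoff_eq_0: "1 \<le> s \<Longrightarrow> cutoff s = 0"
  by (simp add: cutoff_def)

lemma has_real_derivative_cutoff: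
  "(cutoff has_real_derivative - 2 * max 0 (1 - s)) (at s)"
proof (cases s "1 :: real" rule: linorder_cases)
  case less
  have "((\<lambda>s. (1 - s)\<^sup>2) has_real_derivative - 2 * max 0 (1 - s)) (at s)"
    using less by (auto intro!: derivative_eq_intros)
  moreover have "eventually (\<lambda>s. s < 1) (nhds s)"
    using eventually_nhds_in_open[of "{..<1}" s] less by simp
  then have "eventually (\<lambda>s. cutoff s = (1 - s)\<^sup>2) (nhds s)"
    by eventually_elim (simp add: cutoff_def)
  ultimately show ?thesis
    by (rule DERIV_cong_ev[OF refl _ refl, THEN iffD2, rotated])
next
  case greater
  have "((\<lambda>s. 0) has_real_derivative - 2 * max 0 (1 - s)) (at s)"
    using greater by simp
  moreover have "eventually (\<lambda>s. s > 1) (nhds s)"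
    using eventually_nhds_in_open[of "{1<..}" s] greater by simp
  then have "eventually (\<lambda>s. cutoff s = 0) (nhds s)"
    by eventually_elim (simp add: cutoff_def)
  ultimately show ?thesis
    by (rule DERIV_cong_ev[OF refl _ refl, THEN iffD2, rotated])
next
  case equal
  \<comment> \<open>At the junction of the two branches the difference quotient is squeezed by
    |h|.\<close>
  have "(\<lambda>h. (cutoff (1 + h) - cutoff 1) / h) \<midarrow>0\<rightarrow> 0"
  proof (rule Lim_null_comparison)
    have "norm ((cutoff (1 + h) - cutoff 1) / h) \<le> \<bar>h\<bar>" for h
    proof (cases "h < 0")
      case True
      then show ?thesis by (simp add: cutoff_def power2_eq_square)
    next
      case False
      then show ?thesis by (simp add: cutoff_def)
    qed
    then show "eventually (\<lambda>h. norm ((cutoff (1 + h) - cutoff 1) / h) \<le> \<bar>h\<bar>) (at 0)"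
      by simp
    show "(\<lambda>h. \<bar>h\<bar>) \<midarrow>(0::real)\<rightarrow> 0"
      by (rule tendsto_rabs_zero) (rule tendsto_ident_at)
  qed
  then show ?thesis using equal by (simp add: DERIV_def)
qed

text \<open>Using the squared norm keeps the map differentiable at 0, where the norm itself is
  not.\<close>

definition radial_cutoff :: "real \<Rightarrow> ('a::real_inner \<Rightarrow>\<^sub>L 'a) \<Rightarrow> 'a \<Rightarrow> 'a" where
  "radial_cutoff r S x = cutoff ((norm x)\<^sup>2 / r\<^sup>2) *\<^sub>R S x"

text \<open>Product rule: the composition of blinfuns is the rank-one operator sending
  \<open>h\<close> to \<open>(h \<bullet> x) *\<^sub>R S x\<close>.\<close>

definition radial_cutoff_deriv ::
    "real \<Rightarrow> ('a::real_inner \<Rightarrow>\<^sub>L 'a) \<Rightarrow> 'a \<Rightarrow> ('a \<Rightarrow>\<^sub>L 'a)" where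
  "radial_cutoff_deriv r S x = cutoff ((norm x)\<^sup>2 / r\<^sup>2) *\<^sub>R S -
    (4 * max 0 (1 - (norm x)\<^sup>2 / r\<^sup>2) / r\<^sup>2) *\<^sub>R (blinfun_scaleR_left (S x) o\<^sub>L blinfun_inner_left x)"

lemma radial_cutoff_0 [simp]: "radial_cutoff r S 0 = 0"
  by (simp add: radial_cutoff_def blinfun.zero_right)

lemma radial_cutoff_deriv_0 [simp]: "radial_cutoff_deriv r S 0 = S"
  by (intro blinfun_eqI)
    (simp add: radial_cutoff_deriv_def blinfun.bilinear_simps)

lemma radial_cutoff_eq_0:
  assumes "0 < r" "r \<le> norm x"
  shows "radial_cutoff r S x = 0"
proof -
  have "r\<^sup>2 \<le> (norm x)\<^sup>2" using assms by (intro power_mono) auto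
  then show ?thesis using assms by (simp add: radial_cutoff_def cutoff_eq_0)
qed

lemma has_derivative_radial_cutoff:
  "(radial_cutoff r S has_derivative blinfun_apply (radial_cutoff_deriv r S x)) (at x)"
proof -
  have "((\<lambda>x. (norm x)\<^sup>2 / r\<^sup>2) has_derivative (\<lambda>h. 2 * (h \<bullet> x) / r\<^sup>2)) (at x)"
    unfolding power2_norm_eq_inner divide_inverse
    by (auto intro!: derivative_eq_intros simp: inner_commute)
  from has_derivative_compose[OF this has_real_derivative_cutoff[unfolded has_field_derivative_def]]
  have "((\<lambda>x. cutoff ((norm x)\<^sup>2 / r\<^sup>2)) has_derivative
      (\<lambda>h. - 2 * max 0 (1 - (norm x)\<^sup>2 / r\<^sup>2) * (2 * (h \<bullet> x) / r\<^sup>2))) (at x)"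
    .
  then have "((\<lambda>x. cutoff ((norm x)\<^sup>2 / r\<^sup>2) *\<^sub>R S x) has_derivative
      (\<lambda>h. cutoff ((norm x)\<^sup>2 / r\<^sup>2) *\<^sub>R S h +
        (- 2 * max 0 (1 - (norm x)\<^sup>2 / r\<^sup>2) * (2 * (h \<bullet> x) / r\<^sup>2)) *\<^sub>R S x)) (at x)"
    by (intro has_derivative_scaleR bounded_linear_imp_has_derivative blinfun.bounded_linear_right)
  moreover have "blinfun_apply (radial_cutoff_deriv r S x) = (\<lambda>h. cutoff ((norm x)\<^sup>2 / r\<^sup>2) *\<^sub>R S h +
        (- 2 * max 0 (1 - (norm x)\<^sup>2 / r\<^sup>2) * (2 * (h \<bullet> x) / r\<^sup>2)) *\<^sub>R S x)"
    by (auto simp: radial_cutoff_deriv_def blinfun.bilinear_simps)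
  ultimately show ?thesis
    by (simp add: radial_cutoff_def[abs_def])
qed

lemma continuous_on_radial_cutoff_deriv: "continuous_on A (radial_cutoff_deriv r S)"
proof -
  have "continuous_on UNIV cutoff"
    by (meson DERIV_isCont continuous_at_imp_continuous_on has_real_derivative_cutoff)
  then have "continuous_on A (\<lambda>x. cutoff ((norm x)\<^sup>2 / r\<^sup>2))"
    by (rule continuous_on_compose2) (auto intro!: continuous_intros simp: divide_inverse)
  then show ?thesis
    unfolding radial_cutoff_deriv_def divide_inverse by (intro continuous_intros)
qed

text \<open>Differentiating the cutoff costs a factor of order \<open>1 / r\<^sup>2\<close>, but
  \<open>(norm x)\<^sup>2\<close> compensates it, because \<open>max 0 (1 - q) * q\<close> is at
  most 1. The bound is thus independent of \<open>r\<close>, and the radii may shrink as fast as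
  desired.\<close>

lemma norm_radial_cutoff_deriv_le:
  assumes "0 < r"
  shows "norm (radial_cutoff_deriv r S x) \<le> 5 * norm S"
proof -
  let ?q = "(norm x)\<^sup>2 / r\<^sup>2" and ?T = "blinfun_scaleR_left (S x) o\<^sub>L blinfun_inner_left x"
  have "norm ?T \<le> norm S * (norm x)\<^sup>2"
  proof (rule norm_blinfun_bound)
    fix h
    have "norm (?T h) = \<bar>h \<bullet> x\<bar> * norm (S x)" by simp
    also have "\<dots> \<le> (norm h * norm x) * (norm S * norm x)"
      by (intro mult_mono Cauchy_Schwarz_ineq2 norm_blinfun) auto
    finally show "norm (?T h) \<le> norm S * (norm x)\<^sup>2 * norm h"
      by (simp add: power2_eq_square algebra_simps)
  qed simp
  then have "norm ((4 * max 0 (1 - ?q) / r\<^sup>2) *\<^sub>R ?T) \<le> (4 * max 0 (1 - ?q) / r\<^sup>2) * (norm S * (norm x)\<^sup>2)"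
    by (simp add: mult_left_mono divide_right_mono)
  also have "\<dots> = 4 * (max 0 (1 - ?q) * ?q) * norm S"
    by (simp add: algebra_simps)
  also have "\<dots> \<le> 4 * 1 * norm S"
  proof (intro mult_right_mono mult_left_mono)
    have "max 0 (1 - q) * q \<le> 1" if "0 \<le> q" for q :: real
      using that by (cases "q \<le> 1") (auto intro: mult_le_one)
    from this[of ?q] show "max 0 (1 - ?q) * ?q \<le> 1" by simp
  qed auto
  finally have "norm ((4 * max 0 (1 - ?q) / r\<^sup>2) *\<^sub>R ?T) \<le> 4 * norm S" by simp
  moreover have "norm (cutoff ?q *\<^sub>R S) \<le> 1 * norm S"
    using cutoff_nonneg[of ?q] cutoff_le_1[of ?q] by (simp add: mult_left_le_one_le)
  ultimately show ?thesis
    unfolding radial_cutoff_deriv_def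
    using norm_triangle_ineq4[of "cutoff ?q *\<^sub>R S" "(4 * max 0 (1 - ?q) / r\<^sup>2) *\<^sub>R ?T"] by linarith
qed

section \<open>The vector field\<close>

lemma has_derivative_suminf_blinfun:
  fixes f :: "nat \<Rightarrow> 'a::real_normed_vector \<Rightarrow> 'b::banach"
    and f' :: "nat \<Rightarrow> 'a \<Rightarrow> 'a \<Rightarrow>\<^sub>L 'b"
  assumes der: "\<And>n x. (f n has_derivative blinfun_apply (f' n x)) (at x)"
    and bound: "\<And>n x. norm (f' n x) \<le> M n" and "summable M"
    and sum0: "summable (\<lambda>n. f n x0)"
  shows "((\<lambda>x. \<Sum>n. f n x) has_derivative blinfun_apply (\<Sum>n. f' n x)) (at x)"
proof -
  \<comment> \<open>The derivatives converge in operator norm uniformly in \<open>x\<close>; with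
    convergence at the single point \<open>x0\<close> this yields a differentiable limit.\<close>
  have ul: "uniform_limit UNIV (\<lambda>n x. \<Sum>i<n. f' i x) (\<lambda>x. \<Sum>i. f' i x) sequentially"
    by (rule Weierstrass_m_test[OF bound \<open>summable M\<close>])
  have "\<exists>g. \<forall>x\<in>UNIV. (\<lambda>n. \<Sum>i<n. f i x) \<longlonglongrightarrow> g x \<and>
      (g has_derivative blinfun_apply (\<Sum>i. f' i x)) (at x within UNIV)"
  proof (rule has_derivative_sequence)
    show "((\<lambda>x. \<Sum>i<n. f i x) has_derivative blinfun_apply (\<Sum>i<n. f' i x)) (at x within UNIV)"
      for n x
    proof -
      have "((\<lambda>x. \<Sum>i<n. f i x) has_derivative (\<lambda>h. \<Sum>i<n. f' i x h)) (at x)"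
        by (intro has_derivative_sum der)
      moreover have "blinfun_apply (\<Sum>i<n. f' i x) = (\<lambda>h. \<Sum>i<n. f' i x h)"
        by (simp add: fun_eq_iff blinfun.sum_left)
      ultimately show ?thesis by simp
    qed
    show "\<forall>\<^sub>F n in sequentially. \<forall>x\<in>UNIV. \<forall>h.
        norm (blinfun_apply (\<Sum>i<n. f' i x) h - blinfun_apply (\<Sum>i. f' i x) h) \<le> e * norm h"
      if "e > 0" for e
      using uniform_limitD[OF ul that]
    proof eventually_elim
      case (elim n)
      show ?case
      proof (intro ballI allI)
        fix x h
        have "norm (blinfun_apply ((\<Sum>i<n. f' i x) - (\<Sum>i. f' i x)) h)
            \<le> norm ((\<Sum>i<n. f' i x) - (\<Sum>i. f' i x)) * norm h"
          by (rule norm_blinfun)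
        also have "\<dots> \<le> e * norm h"
          using elim by (intro mult_right_mono) (auto simp: dist_norm less_imp_le)
        finally show "norm (blinfun_apply (\<Sum>i<n. f' i x) h - blinfun_apply (\<Sum>i. f' i x) h) \<le> e * norm h"
          by (simp add: blinfun.diff_left)
      qed
    qed
    show "(\<lambda>n. \<Sum>i<n. f i x0) \<longlonglongrightarrow> (\<Sum>i. f i x0)"
      by (rule summable_LIMSEQ[OF sum0])
  qed auto
  then obtain g where g: "\<And>x. (\<lambda>n. \<Sum>i<n. f i x) \<longlonglongrightarrow> g x"
      "\<And>x. (g has_derivative blinfun_apply (\<Sum>i. f' i x)) (at x)"
    by auto
  have "(\<lambda>x. \<Sum>n. f n x) = g"
    using g(1) by (auto simp: sums_def[symmetric] sums_iff)
  then show ?thesis using g(2) by simp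
qed

section \<open>Dyadic levels and the field built from them\<close>

text \<open>The sum is the exponent of 2 in the factorial of \<open>n\<close>. Halving works: odd
  numbers contribute 0, and \<open>2 * m\<close> contributes one more than \<open>m\<close>. The
  bound makes the eigenvector below square-summable.\<close>

lemma sum_multiplicity_2_le: "(\<Sum>i<n. multiplicity 2 (Suc i)) \<le> n"
proof (induction n rule: less_induct)
  case (less n)
  have odd_0: "multiplicity 2 (Suc (2 * i)) = 0" for i :: nat
    by (rule not_dvd_imp_multiplicity_0) simp
  have even_Suc: "multiplicity 2 (Suc (Suc (2 * i))) = Suc (multiplicity 2 (Suc i))" for i :: nat
    using multiplicity_times_same[of "Suc i" "2 :: nat"] by simp
  have double: "(\<Sum>i<2 * q. multiplicity 2 (Suc i)) = q + (\<Sum>i<q. multiplicity 2 (Suc i))" for q :: nat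
    by (induction q) (simp_all add: odd_0 even_Suc)
  show ?case
  proof (cases "n = 0")
    case False
    define q where "q = n div 2"
    have IH: "(\<Sum>i<q. multiplicity 2 (Suc i)) \<le> q"
      using less False by (simp add: q_def)
    have "n = 2 * q \<or> n = Suc (2 * q)"
      unfolding q_def by presburger
    then show ?thesis
    proof
      assume "n = 2 * q"
      then show ?thesis using double[of q] IH by simp
    next
      assume "n = Suc (2 * q)"
      then show ?thesis using double[of q] IH by (simp add: odd_0)
    qed
  qed simp
qed

text \<open>Level \<open>k\<close> of Kakutani's shift with unit weights; \<open>Suc n\<close>
  occurs because coordinates are numbered from 0.\<close>

definition dyadic_shift :: "nat \<Rightarrow> ell2 \<Rightarrow>\<^sub>L ell2" where
  "dyadic_shift k = weighted_shift (\<lambda>n. if multiplicity 2 (Suc n) = k then 1 else 0) 1"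

lemma dyadic_shift_nth:
  "ell2_nth (dyadic_shift k x) n = (if multiplicity 2 (Suc n) = k then ell2_nth x (Suc n) else 0)"
  unfolding dyadic_shift_def by (subst weighted_shift_nth[where C = 1]) auto

lemma norm_dyadic_shift_le: "norm (dyadic_shift k) \<le> 1"
  unfolding dyadic_shift_def by (rule norm_weighted_shift_le) simp

text \<open>The square of \<open>1 / 32 ^ (2 ^ k)\<close>: multiplied by the norm distortion
  \<open>32 ^ (2 ^ k)\<close> it still leaves \<open>1 / 32 ^ (2 ^ k)\<close>, which tends to
  0.\<close>

definition cutoff_radius :: "nat \<Rightarrow> real" where
  "cutoff_radius k = 1 / 32 ^ (2 ^ Suc k)"

lemma cutoff_radius_pos: "0 < cutoff_radius k"
  by (simp add: cutoff_radius_def)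

lemma cutoff_radius_antimono: "k \<le> l \<Longrightarrow> cutoff_radius l \<le> cutoff_radius k"
  by (simp add: cutoff_radius_def frac_le power_increasing)

definition vfield :: "ell2 \<Rightarrow> ell2" where
  "vfield x = (\<Sum>k. (8 / 2 ^ k) *\<^sub>R radial_cutoff (cutoff_radius k) (dyadic_shift k) x) - x"

definition vfield_deriv :: "ell2 \<Rightarrow> ell2 \<Rightarrow>\<^sub>L ell2" where
  "vfield_deriv x =
    (\<Sum>k. (8 / 2 ^ k) *\<^sub>R radial_cutoff_deriv (cutoff_radius k) (dyadic_shift k) x) - id_blinfun"

lemma sums_weights: "(\<lambda>k. 8 / 2 ^ k :: real) sums 16"
  using sums_mult[OF geometric_sums[of "1 / 2 :: real"], of 8]
  by (simp add: power_one_over field_simps)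

lemma norm_vfield_summand_deriv_le:
  "norm ((8 / 2 ^ k) *\<^sub>R radial_cutoff_deriv (cutoff_radius k) (dyadic_shift k) x) \<le> 5 * (8 / 2 ^ k)"
proof -
  have "norm (radial_cutoff_deriv (cutoff_radius k) (dyadic_shift k) x) \<le> 5"
    using norm_radial_cutoff_deriv_le[OF cutoff_radius_pos, of k "dyadic_shift k" x]
      norm_dyadic_shift_le[of k] by linarith
  then show ?thesis by (simp add: divide_right_mono)
qed

lemma summable_weights: "summable (\<lambda>k. 5 * (8 / 2 ^ k) :: real)"
  using sums_weights by (intro summable_mult) (rule sums_summable)

lemma vfield_0: "vfield 0 = 0"
  by (simp add: vfield_def)

lemma has_derivative_vfield: "(vfield has_derivative blinfun_apply (vfield_deriv x)) (at x)"
proof -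
  have "((\<lambda>x. \<Sum>k. (8 / 2 ^ k) *\<^sub>R radial_cutoff (cutoff_radius k) (dyadic_shift k) x) has_derivative
      blinfun_apply (\<Sum>k. (8 / 2 ^ k) *\<^sub>R radial_cutoff_deriv (cutoff_radius k) (dyadic_shift k) x)) (at x)"
  proof (rule has_derivative_suminf_blinfun[OF _ norm_vfield_summand_deriv_le summable_weights])
    show "((\<lambda>x. (8 / 2 ^ k) *\<^sub>R radial_cutoff (cutoff_radius k) (dyadic_shift k) x) has_derivative
        blinfun_apply ((8 / 2 ^ k) *\<^sub>R radial_cutoff_deriv (cutoff_radius k) (dyadic_shift k) x)) (at x)" for k x
      unfolding scaleR_blinfun.rep_eq
      by (intro has_derivative_scaleR_right has_derivative_radial_cutoff)
    \<comment> \<open>The base point is 0, where every summand vanishes.\<close>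
    show "summable (\<lambda>k. (8 / 2 ^ k) *\<^sub>R radial_cutoff (cutoff_radius k) (dyadic_shift k) 0)"
      by simp
  qed
  from has_derivative_diff[OF this has_derivative_ident]
  show ?thesis
    unfolding vfield_def[abs_def] vfield_deriv_def
    by (simp add: minus_blinfun.rep_eq id_blinfun.rep_eq)
qed

lemma continuous_on_vfield_deriv: "continuous_on UNIV vfield_deriv"
proof -
  have "continuous_on UNIV (\<lambda>x. \<Sum>k. (8 / 2 ^ k) *\<^sub>R radial_cutoff_deriv (cutoff_radius k) (dyadic_shift k) x)"
  proof (rule uniform_limit_theorem)
    show "uniform_limit UNIV
        (\<lambda>n x. \<Sum>k<n. (8 / 2 ^ k) *\<^sub>R radial_cutoff_deriv (cutoff_radius k) (dyadic_shift k) x)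
        (\<lambda>x. \<Sum>k. (8 / 2 ^ k) *\<^sub>R radial_cutoff_deriv (cutoff_radius k) (dyadic_shift k) x) sequentially"
      by (rule Weierstrass_m_test[OF norm_vfield_summand_deriv_le summable_weights])
  qed (auto intro!: always_eventually continuous_intros continuous_on_radial_cutoff_deriv)
  then show ?thesis
    unfolding vfield_deriv_def[abs_def] by (intro continuous_intros)
qed

text \<open>The summable derivative bounds are uniform in \<open>x\<close>, so the mean value
  inequality gives a global Lipschitz constant.\<close>

lemma vfield_lipschitz: "\<exists>L>0. \<forall>x y. norm (vfield x - vfield y) \<le> L * norm (x - y)"
proof -
  define L where "L = (\<Sum>k. 5 * (8 / 2 ^ k) :: real) + 1"
  have "norm (vfield_deriv x) \<le> L" for x
  proof -
    have "norm (\<Sum>k. (8 / 2 ^ k) *\<^sub>R radial_cutoff_deriv (cutoff_radius k) (dyadic_shift k) x)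
        \<le> (\<Sum>k. 5 * (8 / 2 ^ k) :: real)"
      by (rule norm_suminf_le[OF norm_vfield_summand_deriv_le summable_weights])
    then show ?thesis
      unfolding vfield_deriv_def L_def by (intro norm_triangle_le_diff add_mono norm_blinfun_id_le)
  qed
  then have "norm (vfield x - vfield y) \<le> L * norm (x - y)" for x y
    by (intro differentiable_bound[of UNIV vfield "\<lambda>x. blinfun_apply (vfield_deriv x)"])
      (auto intro: has_derivative_vfield simp: norm_blinfun.rep_eq[symmetric])
  moreover have "0 < L"
    unfolding L_def using suminf_nonneg[OF summable_weights] by simp
  ultimately show ?thesis by blast
qed

section \<open>The positive eigenvalue of the linearization\<close>

text \<open>At 0 all cutoffs equal 1, so the linearization is the full weighted shift minus the
  identity; the shift has eigenvalue 2.\<close>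

lemma vfield_deriv_0_eigenvector: "\<exists>u. u \<noteq> 0 \<and> blinfun_apply (vfield_deriv 0) u = u"
proof -
  \<comment> \<open>Solves \<open>8 / 2 ^ multiplicity 2 (Suc n) * w (Suc n) = 2 * w n\<close> with
    \<open>w 0 = 1\<close>. The denominators \<open>4 ^ n\<close> beat the numerators, which are at
    most \<open>2 ^ n\<close>.\<close>
  define w where "w n = (\<Prod>i<n. 2 ^ multiplicity 2 (Suc i) / 4 :: real)" for n
  have w_le: "\<bar>w n\<bar> \<le> (1 / 2) ^ n" for n
  proof -
    have "w n = 2 ^ (\<Sum>i<n. multiplicity 2 (Suc i)) / 4 ^ n"
      by (simp add: w_def prod_dividef power_sum)
    also have "\<dots> \<le> 2 ^ n / 4 ^ n"
      using sum_multiplicity_2_le[of n] by (intro divide_right_mono power_increasing) auto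
    also have "\<dots> = (1 / 2) ^ n"
      by (simp add: power_divide[symmetric])
    finally show ?thesis
      by (simp add: w_def prod_nonneg)
  qed
  define u where "u = Abs_ell2 w"
  have "summable (\<lambda>n. (w n)\<^sup>2)"
  proof (rule summable_comparison_test')
    show "summable (\<lambda>n. (1 / 4 :: real) ^ n)" by simp
    show "norm ((w n)\<^sup>2) \<le> (1 / 4) ^ n" for n
      using power_mono[OF w_le[of n], of 2] by (simp add: power_even_eq[symmetric] power2_eq_square power_mult_distrib[symmetric])
  qed
  then have u: "ell2_nth u n = w n" for n
    by (simp add: u_def Abs_ell2_inverse)
  have "ell2_nth (blinfun_apply (vfield_deriv 0) u) n = ell2_nth u n" for n
  proof -
    let ?v = "multiplicity 2 (Suc n)"
    let ?A = "\<lambda>k. (8 / 2 ^ k :: real) *\<^sub>R dyadic_shift k"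
    \<comment> \<open>Evaluating a coordinate is continuous in the operator, so it commutes with the
      series.\<close>
    have coord: "bounded_linear (\<lambda>A :: ell2 \<Rightarrow>\<^sub>L ell2. ell2_nth (blinfun_apply A u) n)"
    proof (rule bounded_linear_intro[where K = "norm u"])
      show "norm (ell2_nth (blinfun_apply A u) n) \<le> norm A * norm u" for A :: "ell2 \<Rightarrow>\<^sub>L ell2"
        using abs_ell2_nth_le_norm[of "A u" n] norm_blinfun[of A u] by simp
    qed (simp_all add: blinfun.bilinear_simps)
    have "summable ?A"
      using norm_vfield_summand_deriv_le[of _ 0]
      by (intro summable_comparison_test'[OF summable_weights]) simp
    then have "ell2_nth (blinfun_apply (\<Sum>k. ?A k) u) n = (\<Sum>k. ell2_nth (blinfun_apply (?A k) u) n)"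
      by (rule bounded_linear.suminf[OF coord])
    \<comment> \<open>Row \<open>n\<close> belongs to exactly one level.\<close>
    also have "\<dots> = (\<Sum>k\<in>{?v}. ell2_nth (blinfun_apply (?A k) u) n)"
      by (rule suminf_finite) (auto simp: blinfun.bilinear_simps dyadic_shift_nth)
    also have "\<dots> = 2 * w n"
      by (simp add: blinfun.bilinear_simps dyadic_shift_nth u w_def)
    finally show ?thesis
      by (simp add: vfield_deriv_def blinfun.bilinear_simps id_blinfun.rep_eq u)
  qed
  then have "blinfun_apply (vfield_deriv 0) u = u" by (rule ell2_eqI)
  moreover have "u \<noteq> 0" using u[of 0] by (auto simp: w_def)
  ultimately show ?thesis by blast
qed

text \<open>The vector \<open>(u, 0)\<close> lies in the kernel of the complexified
  \<open>c - A\<close>, which therefore has no left inverse.\<close>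

lemma eigenvalue_in_operator_spectrum:
  assumes "u \<noteq> 0" "blinfun_apply A u = c *\<^sub>R u"
  shows "complex_of_real c \<in> operator_spectrum A"
proof -
  let ?w = "cplx_scale (complex_of_real c) (u, 0) - complexification A (u, 0)"
  have "?w = 0"
    using assms by (simp add: cplx_scale_def blinfun.zero_right zero_prod_def)
  then have "blinfun_apply B ?w = 0" for B :: "('a \<times> 'a) \<Rightarrow>\<^sub>L ('a \<times> 'a)"
    by (simp only: blinfun.zero_right)
  moreover have "(u, 0 :: 'a) \<noteq> 0"
    using assms by (simp add: zero_prod_def)
  ultimately have "blinfun_apply B ?w \<noteq> (u, 0)" for B :: "('a \<times> 'a) \<Rightarrow>\<^sub>L ('a \<times> 'a)"
    by metis
  then show ?thesis
    unfolding operator_spectrum_def by blast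
qed

section \<open>Global asymptotic stability\<close>

text \<open>The weighted norm is encoded as the norm of a diagonal image: weights grow by the factor
  32 inside a block of length \<open>2 ^ K\<close> and restart at 1 in the next.\<close>

definition dyadic_scaling :: "nat \<Rightarrow> ell2 \<Rightarrow>\<^sub>L ell2" where
  "dyadic_scaling K = weighted_shift (\<lambda>n. 32 ^ (n mod 2 ^ K)) 0"

lemma dyadic_scaling_weight_le: "\<bar>32 ^ (n mod 2 ^ K) :: real\<bar> \<le> 32 ^ (2 ^ K)"
  using power_increasing[of "n mod 2 ^ K" "2 ^ K" "32 :: real"] by (simp add: less_imp_le)

lemma dyadic_scaling_nth: "ell2_nth (dyadic_scaling K x) n = 32 ^ (n mod 2 ^ K) * ell2_nth x n"
  unfolding dyadic_scaling_def by (subst weighted_shift_nth[OF dyadic_scaling_weight_le]) simp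

lemma norm_dyadic_scaling_le: "norm (dyadic_scaling K x) \<le> 32 ^ (2 ^ K) * norm x"
proof -
  have "norm (dyadic_scaling K) \<le> 32 ^ (2 ^ K)"
    unfolding dyadic_scaling_def by (rule norm_weighted_shift_le[OF dyadic_scaling_weight_le])
  then show ?thesis
    using norm_blinfun[of "dyadic_scaling K" x] by (meson mult_right_mono norm_ge_zero order_trans)
qed

lemma norm_le_dyadic_scaling: "norm x \<le> norm (dyadic_scaling K x)"
proof -
  have "norm x \<le> 1 * norm (dyadic_scaling K x)"
  proof (rule norm_ell2_le_shift[where j = 0])
    show "\<bar>ell2_nth x n\<bar> \<le> 1 * \<bar>ell2_nth (dyadic_scaling K x) (n + 0)\<bar>" for n
      using mult_right_mono[of 1 "32 ^ (n mod 2 ^ K)" "\<bar>ell2_nth x n\<bar>"]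
      by (simp add: dyadic_scaling_nth abs_mult)
  qed simp
  then show ?thesis by simp
qed

text \<open>A row of level below \<open>K\<close> is never the last of its block, so the entry moves
  from \<open>n + 1\<close> to \<open>n\<close> within one block, where the weight drops by the
  factor 32.\<close>

lemma norm_dyadic_scaling_shift_le:
  assumes "k < K"
  shows "norm (dyadic_scaling K (dyadic_shift k x)) \<le> norm (dyadic_scaling K x) / 32"
proof -
  have "norm (dyadic_scaling K (dyadic_shift k x)) \<le> 1 / 32 * norm (dyadic_scaling K x)"
  proof (rule norm_ell2_le_shift[where j = 1])
    fix n
    show "\<bar>ell2_nth (dyadic_scaling K (dyadic_shift k x)) n\<bar>
        \<le> 1 / 32 * \<bar>ell2_nth (dyadic_scaling K x) (n + 1)\<bar>"
    proof (cases "multiplicity 2 (Suc n) = k")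
      case True
      then have "\<not> 2 ^ K dvd Suc n"
        using assms power_dvd_iff_le_multiplicity[of "Suc n" "2 :: nat" K] by simp
      then have "Suc n mod 2 ^ K = Suc (n mod 2 ^ K)"
        by (metis dvd_eq_mod_eq_0 mod_Suc)
      then show ?thesis
        using True by (simp add: dyadic_scaling_nth dyadic_shift_nth abs_mult)
    qed (simp add: dyadic_scaling_nth dyadic_shift_nth)
  qed simp
  then show ?thesis by simp
qed

text \<open>The weights \<open>8 / 2 ^ k\<close> sum to 16 and each active shift has scaled norm at
  most 1/32, so the shifts contribute at most 1/2 against the damping term
  \<open>- x\<close>.\<close>

lemma inner_dyadic_scaling_vfield_le:
  assumes "cutoff_radius K \<le> norm x"
  shows "dyadic_scaling K x \<bullet> dyadic_scaling K (vfield x) \<le> - (norm (dyadic_scaling K x))\<^sup>2 / 2"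
proof -
  let ?D = "dyadic_scaling K"
  define z where "z = (\<Sum>k<K. (8 / 2 ^ k) *\<^sub>R radial_cutoff (cutoff_radius k) (dyadic_shift k) x)"
  \<comment> \<open>The radii decrease, so outside the ball of radius \<open>cutoff_radius K\<close>
    all levels from \<open>K\<close> on are switched off.\<close>
  have "(8 / 2 ^ k) *\<^sub>R radial_cutoff (cutoff_radius k) (dyadic_shift k) x = 0" if "k \<notin> {..<K}" for k
    using that assms cutoff_radius_antimono[of K k] by (simp add: radial_cutoff_eq_0 cutoff_radius_pos)
  then have "vfield x = z - x"
    unfolding vfield_def z_def by (subst suminf_finite[of "{..<K}"]) auto
  then have "?D x \<bullet> ?D (vfield x) = ?D x \<bullet> ?D z - (norm (?D x))\<^sup>2"
    by (simp add: blinfun.diff_right inner_diff_right power2_norm_eq_inner)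
  also have "?D x \<bullet> ?D z \<le> norm (?D x) * norm (?D z)"
    by (rule norm_cauchy_schwarz)
  also have "norm (?D z) \<le> norm (?D x) / 2"
  proof -
    have "norm (?D z) \<le> (\<Sum>k<K. norm (?D ((8 / 2 ^ k) *\<^sub>R radial_cutoff (cutoff_radius k) (dyadic_shift k) x)))"
      unfolding z_def blinfun.sum_right by (rule norm_sum)
    also have "\<dots> \<le> (\<Sum>k<K. 8 / 2 ^ k * (norm (?D x) / 32))"
    proof (rule sum_mono)
      fix k assume "k \<in> {..<K}"
      let ?q = "cutoff ((norm x)\<^sup>2 / (cutoff_radius k)\<^sup>2)"
      have "norm (?D (radial_cutoff (cutoff_radius k) (dyadic_shift k) x)) = ?q * norm (?D (dyadic_shift k x))"
        using cutoff_nonneg by (simp add: radial_cutoff_def blinfun.scaleR_right)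
      also have "\<dots> \<le> 1 * (norm (?D x) / 32)"
        using \<open>k \<in> {..<K}\<close>
        by (intro mult_mono cutoff_le_1 norm_dyadic_scaling_shift_le) auto
      finally have "8 / 2 ^ k * norm (?D (radial_cutoff (cutoff_radius k) (dyadic_shift k) x))
          \<le> 8 / 2 ^ k * (1 * (norm (?D x) / 32))"
        by (intro mult_left_mono) auto
      then show "norm (?D ((8 / 2 ^ k) *\<^sub>R radial_cutoff (cutoff_radius k) (dyadic_shift k) x))
          \<le> 8 / 2 ^ k * (norm (?D x) / 32)"
        by (simp only: blinfun.scaleR_right norm_scaleR) simp
    qed
    also have "\<dots> = (\<Sum>k<K. 8 / 2 ^ k) * (norm (?D x) / 32)"
      by (simp add: sum_distrib_right)
    also have "\<dots> \<le> 16 * (norm (?D x) / 32)"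
      using sum_le_suminf[OF sums_summable[OF sums_weights], of "{..<K}"] sums_unique[OF sums_weights]
      by (intro mult_right_mono) auto
    finally show ?thesis by simp
  qed
  finally show ?thesis
    by (simp add: mult_left_mono power2_eq_square)
qed

section \<open>Decay and trapping along solutions\<close>

text \<open>The factor 1/2 in the inner product estimate exactly balances the growth of
  \<open>exp\<close>. The condition \<open>far\<close> concerns interior times, so that the interval
  may start at a point of the ball.\<close>

lemma dyadic_scaling_exp_decay:
  assumes sol: "ode_solution vfield x {0..}" and "0 \<le> s" "s \<le> t"
    and far: "\<And>\<tau>. s < \<tau> \<Longrightarrow> \<tau> < t \<Longrightarrow> cutoff_radius K \<le> norm (x \<tau>)"
  shows "exp t * (norm (dyadic_scaling K (x t)))\<^sup>2 \<le> exp s * (norm (dyadic_scaling K (x s)))\<^sup>2"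
proof -
  \<comment> \<open>The factor 1 fits the pattern \<open>c * s\<close> of the energy
    derivative.\<close>
  define d where "d \<tau> = exp (1 * \<tau>) * (norm (dyadic_scaling K (x \<tau>)))\<^sup>2" for \<tau>
  have sub: "{s..t} \<subseteq> {0..}" using \<open>0 \<le> s\<close> by auto
  have "d s \<ge> d t"
  proof (rule DERIV_nonpos_imp_decreasing_open[OF \<open>s \<le> t\<close>])
    fix \<tau> assume \<tau>: "s < \<tau>" "\<tau> < t"
    let ?y = "dyadic_scaling K (x \<tau>)" and ?w = "dyadic_scaling K (vfield (x \<tau>))"
    have "((\<lambda>\<tau>. dyadic_scaling K (x \<tau>)) has_vector_derivative ?w) (at \<tau>)"
      by (rule bounded_linear.has_vector_derivative[OF blinfun.bounded_linear_right
            ode_solution_interior[OF sol sub \<tau>]])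
    then have "(d has_real_derivative exp (1 * \<tau>) * (1 * (norm ?y)\<^sup>2 + 2 * (?y \<bullet> ?w))) (at \<tau>)"
      unfolding d_def by (rule has_real_derivative_exp_norm_square)
    moreover have "1 * (norm ?y)\<^sup>2 + 2 * (?y \<bullet> ?w) \<le> 0"
      using inner_dyadic_scaling_vfield_le[OF far[OF \<tau>]] by simp
    ultimately show "\<exists>y. DERIV d \<tau> :> y \<and> y \<le> 0"
      by (meson exp_ge_zero mult_nonneg_nonpos)
  next
    show "continuous_on {s..t} d"
      unfolding d_def
      by (intro continuous_intros continuous_on_subset[OF ode_solution_continuous_on[OF sol] sub])
  qed
  then show ?thesis by (simp add: d_def)
qed

text \<open>After the last visit to the ball up to time \<open>t\<close> the scaled norm cannot
  grow, so only the norm distortion at that visit is lost.\<close>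

lemma cutoff_radius_trapping:
  assumes sol: "ode_solution vfield x {0..}" and "0 \<le> s" "s \<le> t"
    and start: "norm (x s) \<le> cutoff_radius K"
  shows "norm (x t) \<le> 1 / 32 ^ (2 ^ K)"
proof -
  \<comment> \<open>The last visit exists because the visiting times form a nonempty compact
    set.\<close>
  obtain s' where s': "s' \<in> {s..t}" "norm (x s') \<le> cutoff_radius K"
    and last: "\<And>\<tau>. \<tau> \<in> {s..t} \<Longrightarrow> norm (x \<tau>) \<le> cutoff_radius K \<Longrightarrow> \<tau> \<le> s'"
  proof -
    let ?A = "{s..t} \<inter> (\<lambda>\<tau>. norm (x \<tau>)) -` {..cutoff_radius K}"
    have "continuous_on {s..t} (\<lambda>\<tau>. norm (x \<tau>))"
      by (intro continuous_intros continuous_on_subset[OF ode_solution_continuous_on[OF sol]])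
        (use \<open>0 \<le> s\<close> in auto)
    then have "closed ?A"
      by (rule continuous_closed_preimage) auto
    moreover have "bounded ?A"
      by (rule bounded_subset[OF bounded_closed_interval[of s t]]) auto
    ultimately have "compact ?A"
      by (simp add: compact_eq_bounded_closed)
    moreover have "s \<in> ?A"
      using start \<open>s \<le> t\<close> by simp
    ultimately show ?thesis
      using that compact_attains_sup[of ?A] by blast
  qed
  have "exp t * (norm (dyadic_scaling K (x t)))\<^sup>2 \<le> exp s' * (norm (dyadic_scaling K (x s')))\<^sup>2"
  proof (rule dyadic_scaling_exp_decay[OF sol])
    fix \<tau> assume "s' < \<tau>" "\<tau> < t"
    then show "cutoff_radius K \<le> norm (x \<tau>)"
      using last[of \<tau>] s' by force
  qed (use s' \<open>0 \<le> s\<close> in auto)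
  \<comment> \<open>Monotonicity is enough here; the exponential gain is given up.\<close>
  also have "\<dots> \<le> exp t * (norm (dyadic_scaling K (x s')))\<^sup>2"
    using s' by (intro mult_right_mono) auto
  finally have "norm (dyadic_scaling K (x t)) \<le> norm (dyadic_scaling K (x s'))"
    by (simp add: power2_le_iff_abs_le)
  also have "\<dots> \<le> 32 ^ (2 ^ K) * cutoff_radius K"
    using norm_dyadic_scaling_le[of K "x s'"] s'(2)
    by (meson mult_left_mono order_trans zero_le_numeral zero_le_power)
  also have "\<dots> = 1 / 32 ^ (2 ^ K)"
    by (simp add: cutoff_radius_def power_mult[symmetric] mult_2 power_add)
  finally show ?thesis
    using norm_le_dyadic_scaling[of "x t" K] by linarith
qed

text \<open>A solution staying outside the ball would decay exponentially forever, yet its scaled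
  norm is bounded below by the radius.\<close>

lemma cutoff_radius_reached:
  assumes sol: "ode_solution vfield x {0..}"
  shows "\<exists>s\<ge>0. norm (x s) \<le> cutoff_radius K"
proof (rule ccontr)
  assume "\<not> ?thesis"
  then have far: "cutoff_radius K < norm (x s)" if "0 \<le> s" for s
    using that by force
  define c where "c = (norm (dyadic_scaling K (x 0)))\<^sup>2 / (cutoff_radius K)\<^sup>2"
  have "exp t \<le> c" if "0 \<le> t" for t
  proof -
    have "exp t * (cutoff_radius K)\<^sup>2 \<le> exp t * (norm (dyadic_scaling K (x t)))\<^sup>2"
      using far[OF that] norm_le_dyadic_scaling[of "x t" K] cutoff_radius_pos[of K]
      by (intro mult_left_mono power_mono) auto
    also have "\<dots> \<le> exp 0 * (norm (dyadic_scaling K (x 0)))\<^sup>2"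
      using that far by (intro dyadic_scaling_exp_decay[OF sol]) (auto intro: less_imp_le)
    finally show ?thesis
      using cutoff_radius_pos[of K] by (simp add: c_def pos_le_divide_eq)
  qed
  \<comment> \<open>The time \<open>t = c\<close> suffices, since \<open>exp c\<close> is at least
    \<open>1 + c\<close>.\<close>
  from this[of c] have "exp c \<le> c" by (simp add: c_def)
  then show False using exp_ge_add_one_self[of c] by linarith
qed

lemma ex_inverse_power_less:
  assumes "0 < e"
  shows "\<exists>K. 1 / 32 ^ (2 ^ K) < (e :: real)"
proof -
  obtain K where "(1 / 32) ^ K < e"
    using real_arch_pow_inv[OF assms, of "1 / 32"] by auto
  moreover have "(1 / 32 :: real) ^ (2 ^ K) \<le> (1 / 32) ^ K"
    by (intro power_decreasing) (auto simp: less_imp_le)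
  ultimately have "1 / 32 ^ (2 ^ K) < e" by (simp add: power_one_over)
  then show ?thesis by blast
qed

section \<open>From trapping to stability\<close>

lemma maximal_vfield_solution:
  assumes "maximal_ode_solution vfield x J"
  shows "J = {0..}" and "ode_solution vfield x {0..}"
proof -
  obtain L where "0 < L" "\<And>x y. norm (vfield x - vfield y) \<le> L * norm (x - y)"
    using vfield_lipschitz by blast
  then show "J = {0..}"
    using assms by (rule lipschitz_maximal_ode_solution)
  then show "ode_solution vfield x {0..}"
    using assms by (simp add: maximal_ode_solution_def)
qed

text \<open>Trapping from time 0, with \<open>cutoff_radius K\<close> as \<delta> for a
  \<open>K\<close> that makes the trapping radius smaller than \<eta>.\<close>

lemma lyapunov_stable_vfield: "lyapunov_stable vfield"
  unfolding lyapunov_stable_def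
proof (intro allI impI)
  fix \<eta> :: real assume "0 < \<eta>"
  then obtain K where K: "1 / 32 ^ (2 ^ K) < \<eta>"
    using ex_inverse_power_less by blast
  show "\<exists>\<delta>>0. \<forall>x J. maximal_ode_solution vfield x J \<longrightarrow> norm (x 0) < \<delta> \<longrightarrow>
      J = {0..} \<and> (\<forall>t\<ge>0. norm (x t) < \<eta>)"
  proof (intro exI[of _ "cutoff_radius K"] conjI allI impI cutoff_radius_pos)
    fix x J t assume max: "maximal_ode_solution vfield x J" and "norm (x 0) < cutoff_radius K"
    show "J = {0..}" by (rule maximal_vfield_solution[OF max])
    assume "0 \<le> (t :: real)"
    then show "norm (x t) < \<eta>"
      using cutoff_radius_trapping[OF maximal_vfield_solution(2)[OF max], of 0 t K] K
        \<open>norm (x 0) < cutoff_radius K\<close> by simp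
  qed
qed

text \<open>For each \<open>K\<close> the solution reaches the small ball and is trapped from then
  on; the trapping radii tend to 0.\<close>

lemma globally_asymptotically_stable_vfield: "globally_asymptotically_stable vfield"
  unfolding globally_asymptotically_stable_def
proof (intro conjI allI impI lyapunov_stable_vfield)
  fix x J assume max: "maximal_ode_solution vfield x J"
  show "J = {0..}" by (rule maximal_vfield_solution[OF max])
  have sol: "ode_solution vfield x {0..}" by (rule maximal_vfield_solution[OF max])
  show "((\<lambda>t. norm (x t)) \<longlongrightarrow> 0) at_top"
  proof (rule tendstoI)
    fix e :: real assume "0 < e"
    then obtain K where K: "1 / 32 ^ (2 ^ K) < e"
      using ex_inverse_power_less by blast
    obtain s where s: "0 \<le> s" "norm (x s) \<le> cutoff_radius K"
      using cutoff_radius_reached[OF sol] by blast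
    have "dist (norm (x t)) 0 < e" if "s \<le> t" for t
      using cutoff_radius_trapping[OF sol s(1) that s(2)] K by simp
    then show "\<forall>\<^sub>F t in at_top. dist (norm (x t)) 0 < e"
      by (auto simp: eventually_at_top_linorder)
  qed
qed

lemma globally_imp_asymptotically_stable:
  "globally_asymptotically_stable F \<Longrightarrow> asymptotically_stable F"
  unfolding globally_asymptotically_stable_def asymptotically_stable_def
  using zero_less_one by blast

theorem mainTheorem1:
  shows "\<exists>(F :: ell2 \<Rightarrow> ell2) (DF :: ell2 \<Rightarrow> ell2 \<Rightarrow>\<^sub>L ell2).
    (\<forall>x. (F has_derivative blinfun_apply (DF x)) (at x)) \<and>
    continuous_on UNIV DF \<and>
    F 0 = 0 \<and>
    operator_spectrum (DF 0) \<inter> {z. Re z > 0} \<noteq> {} \<and>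
    asymptotically_stable F \<and>
    globally_asymptotically_stable F"
proof (intro exI[of _ vfield] exI[of _ vfield_deriv] conjI allI)
  obtain u where "u \<noteq> 0" "blinfun_apply (vfield_deriv 0) u = 1 *\<^sub>R u"
    using vfield_deriv_0_eigenvector by auto
  then have "complex_of_real 1 \<in> operator_spectrum (vfield_deriv 0)"
    by (rule eigenvalue_in_operator_spectrum)
  then show "operator_spectrum (vfield_deriv 0) \<inter> {z. Re z > 0} \<noteq> {}"
    by force
qed (simp_all add: has_derivative_vfield continuous_on_vfield_deriv vfield_0
    globally_asymptotically_stable_vfield globally_imp_asymptotically_stable)

end
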